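(* Let $\mathcal{S}$ be a seed pattern of geometric type with extended rank $(r,l)$ and frozen variables ${\bf p}$. Suppose that $\mathcal{A}_{\mathbb Z}(\mathcal{S},\emptyset)$ is generated over $\mathbb{Z}$ by a subset $\mathcal{Z}$ of $\widetilde{\mathfrak X}(\mathcal{S})$, and let $(u_1,\ldots,u_{r+l})$ be any extended cluster of $\mathcal{S}$. Then for any subset ${\rm inv}\subset{\bf p}$, a $\mathbb{Q}$-algebra homomorphism $h:\mathcal{A}_{\mathbb Q}(\mathcal{S},{\rm inv})\to\mathbb{Q}$ is a frieze if and only if the following two conditions hold: 1) $h(z)\in\mathbb{Z}$ for every $z\in\mathcal{Z}$, and 2) $h(u_j)>0$ for every $j\in[1,r+l]$.
   Context: Notation: $[m,n]$ is the set of integers $k$ with $m\le k\le n$; $[a]_+=\max(a,0)$, applied entrywise to integer matrices. For ${\bf a}=(a_1,\dots,a_n)$ and an integer column vector $L=(l_1,\dots,l_n)^T$, ${\bf a}^L=a_1^{l_1}\cdots a_n^{l_n}$. Cluster algebras of geometric type. Let $\mathbb{F}$ be a field of rational functions over $\mathbb{Q}$ in $r+l$ independent variables. A seed of extended rank $(r,l)$ in $\mathbb F$ is $\Sigma=({\bf u},{\bf p},\widetilde B)$, where ${\bf u}=(u_1,\ldots,u_r)$ (the cluster) and ${\bf p}=(p_1,\ldots,p_l)$ together freely generate $\mathbb{F}$ over $\mathbb{Q}$ (and $({\bf u},{\bf p})$ is the extended cluster), and $\widetilde B=\binom{B}{P}=(b_{i,j})$ is an $(r+l)\times r$ integer matrix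 whose top $r\times r$ part $B$ is skew-symmetrizable. With $B_k,P_k$ the $k$th columns of $B,P$, the mutation $\mu_k(\Sigma)=({\bf u}',{\bf p},\widetilde B')$, $k\in[1,r]$, has $u'_j=u_j$ for $j\ne k$, $u_ku_k'={\bf u}^{[B_k]_+}{\bf p}^{[P_k]_+}+{\bf u}^{[-B_k]_+}{\bf p}^{[-P_k]_+}$, and $b'_{i,j}=-b_{i,j}$ if $i=k$ or $j=k$, $b'_{i,j}=b_{i,j}+[b_{i,k}]_+[b_{k,j}]_+-[-b_{i,k}]_+[-b_{k,j}]_+$ otherwise. Let $\mathbb{T}_r$ be the $r$-regular tree with edges at each vertex labelled by $[1,r]$. A seed pattern $\mathcal{S}=\{\Sigma_t=({\bf u}_t,{\bf p},\widetilde B_t):t\in\mathbb{T}_r\}$ assigns seeds to vertices so that $\Sigma_{t'}=\mu_k(\Sigma_t)$ whenever $t,t'$ are joined by an edge labelled $k$. Entries of the ${\bf u}_t$ are cluster variables, entries of ${\bf p}$ are frozen variables; $\widetilde{\mathfrak X}(\mathcal{S})$ is the set of all of them (extended cluster variables). The tuple ${\bf p}$ also denotes the set of its entries. For ${\rm inv}\subset{\bf p}$, $\mathcal{A}_{\mathbb Z}(\mathcal{S},{\rm inv})\subset\mathbb{F}$ is the subring generated by $\widetilde{\mathfrak X}(\mathcal{S})$ and all $p_j^{-1}$ with $p_j\in{\rm inv}$, and $\mathcal{A}_{\mathbb Q}(\mathcal{S},{\rm inv})=\mathcal{A}_{\mathbb Z}(\mathcal{S},{\rm inv})\otimes_{\mathbb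 Z}\mathbb{Q}$. A frieze of $\mathcal{A}_{\mathbb Q}(\mathcal{S},{\rm inv})$ is a $\mathbb{Q}$-algebra homomorphism $h:\mathcal{A}_{\mathbb Q}(\mathcal{S},{\rm inv})\to\mathbb{Q}$ such that $h(u)\in\mathbb{Z}_{>0}$ for every $u\in\widetilde{\mathfrak X}(\mathcal{S})$. *)

theory Defs
  imports Complex_Main "HOL-Library.Poly_Mapping"
begin

section \<open>Generated subrings and subfields, free generation\<close>

definition is_subring :: "'a::ring_1 set \<Rightarrow> bool" where
  "is_subring R \<longleftrightarrow> 1 \<in> R \<and> (\<forall>x\<in>R. \<forall>y\<in>R. x - y \<in> R \<and> x * y \<in> R)"

definition is_subfield :: "'a::field set \<Rightarrow> bool" where
  "is_subfield K \<longleftrightarrow> is_subring K \<and> (\<forall>x\<in>K. inverse x \<in> K)"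

text \<open>A polynomial over the rationals in variables indexed by \<^typ>\<open>nat\<close> is a finitely supported
  map from monomials to coefficients, a monomial being a finitely supported map from variables to
  exponents.\<close>

type_synonym rat_mpoly = "(nat \<Rightarrow>\<^sub>0 nat) \<Rightarrow>\<^sub>0 rat"

definition eval_mpoly :: "(nat \<Rightarrow> 'a::field_char_0) \<Rightarrow> rat_mpoly \<Rightarrow> 'a" where
  "eval_mpoly x P = (\<Sum>m\<in>Poly_Mapping.keys P. of_rat (Poly_Mapping.lookup P m) *
      (\<Prod>i\<in>Poly_Mapping.keys m. x i ^ Poly_Mapping.lookup m i))"

definition alg_independent_on :: "nat set \<Rightarrow> (nat \<Rightarrow> 'a::field_char_0) \<Rightarrow> bool" where
  "alg_independent_on I x \<longleftrightarrow>
     (\<forall>P. (\<forall>m\<in>Poly_Mapping.keys P. Poly_Mapping.keys m \<subseteq> I) \<longrightarrow> eval_mpoly x P = 0 \<longrightarrow> P = 0)"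

text \<open>The field \<open>\<bbbF>\<close> is the whole type \<^typ>\<open>'a::field_char_0\<close>: if some family indexed by
  \<open>{1..r+l}\<close> freely generates it, it is a field of rational functions over the rationals in
  \<open>r + l\<close> variables.\<close>

definition freely_generates :: "nat set \<Rightarrow> (nat \<Rightarrow> 'a::field_char_0) \<Rightarrow> bool" where
  "freely_generates I x \<longleftrightarrow>
     alg_independent_on I x \<and> is_subfield hull (range of_rat \<union> x ` I) = UNIV"

section \<open>Seeds and mutations\<close>

text \<open>Clusters are indexed by \<open>{1..r}\<close>, frozen variables by \<open>{1..l}\<close>, and the entries \<open>b i j\<close> of
  the extended exchange matrix by \<open>i \<in> {1..r+l}\<close>, \<open>j \<in> {1..r}\<close>; values at other indices are
  junk and are never inspected.\<close>

record 'a seed =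
  cluster :: "nat \<Rightarrow> 'a"
  frozen :: "nat \<Rightarrow> 'a"
  exmat :: "nat \<Rightarrow> nat \<Rightarrow> int"

definition ext_cluster :: "nat \<Rightarrow> 'a seed \<Rightarrow> nat \<Rightarrow> 'a" where
  "ext_cluster r \<Sigma> j = (if j \<le> r then cluster \<Sigma> j else frozen \<Sigma> (j - r))"

definition skew_symmetrizable :: "nat \<Rightarrow> (nat \<Rightarrow> nat \<Rightarrow> int) \<Rightarrow> bool" where
  "skew_symmetrizable r b \<longleftrightarrow>
     (\<exists>d :: nat \<Rightarrow> int. (\<forall>i\<in>{1..r}. d i > 0) \<and>
        (\<forall>i\<in>{1..r}. \<forall>j\<in>{1..r}. d i * b i j = - (d j * b j i)))"

definition is_seed :: "nat \<Rightarrow> nat \<Rightarrow> 'a::field_char_0 seed \<Rightarrow> bool" where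
  "is_seed r l \<Sigma> \<longleftrightarrow>
     freely_generates {1..r+l} (ext_cluster r \<Sigma>) \<and> skew_symmetrizable r (exmat \<Sigma>)"

definition pos_part :: "int \<Rightarrow> int" where
  "pos_part a = max a 0"

definition is_mutation :: "nat \<Rightarrow> nat \<Rightarrow> nat \<Rightarrow> 'a::field_char_0 seed \<Rightarrow> 'a seed \<Rightarrow> bool" where
  "is_mutation r l k \<Sigma> \<Sigma>' \<longleftrightarrow>
     (let u = cluster \<Sigma>; u' = cluster \<Sigma>'; p = frozen \<Sigma>; p' = frozen \<Sigma>';
          b = exmat \<Sigma>; b' = exmat \<Sigma>'
      in (\<forall>j\<in>{1..l}. p' j = p j) \<and>
         (\<forall>j\<in>{1..r}. j \<noteq> k \<longrightarrow> u' j = u j) \<and>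
         u k * u' k =
           (\<Prod>i=1..r. u i powi pos_part (b i k)) *
             (\<Prod>i=1..l. p i powi pos_part (b (r + i) k)) +
           (\<Prod>i=1..r. u i powi pos_part (- b i k)) *
             (\<Prod>i=1..l. p i powi pos_part (- b (r + i) k)) \<and>
         (\<forall>i\<in>{1..r+l}. \<forall>j\<in>{1..r}. b' i j =
           (if i = k \<or> j = k then - b i j
            else b i j + pos_part (b i k) * pos_part (b k j)
                       - pos_part (- b i k) * pos_part (- b k j))))"

section \<open>The labelled regular tree and seed patterns\<close>

text \<open>\<open>adj t k t'\<close> says that \<open>t\<close> and \<open>t'\<close> are joined by an edge labelled \<open>k\<close>.
  The last two clauses are connectedness and absence of cycles.\<close>

definition labelled_regular_tree :: "nat \<Rightarrow> 't set \<Rightarrow> ('t \<Rightarrow> nat \<Rightarrow> 't \<Rightarrow> bool) \<Rightarrow> bool" where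
  "labelled_regular_tree r V adj \<longleftrightarrow>
     V \<noteq> {} \<and>
     (\<forall>t k t'. adj t k t' \<longrightarrow> t \<in> V \<and> t' \<in> V \<and> k \<in> {1..r} \<and> t \<noteq> t' \<and> adj t' k t) \<and>
     (\<forall>t k k' t'. adj t k t' \<longrightarrow> adj t k' t' \<longrightarrow> k = k') \<and>
     (\<forall>t\<in>V. \<forall>k\<in>{1..r}. \<exists>!t'. adj t k t') \<and>
     (\<forall>t\<in>V. \<forall>t'\<in>V. (\<lambda>x y. \<exists>k. adj x k y)\<^sup>*\<^sup>* t t') \<and>
     \<not> (\<exists>c. length c \<ge> 3 \<and> distinct c \<and> successively (\<lambda>x y. \<exists>k. adj x k y) c \<and>
            (\<exists>k. adj (last c) k (hd c)))"

definition seed_pattern ::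
  "nat \<Rightarrow> nat \<Rightarrow> 't set \<Rightarrow> ('t \<Rightarrow> nat \<Rightarrow> 't \<Rightarrow> bool) \<Rightarrow> (nat \<Rightarrow> 'a::field_char_0) \<Rightarrow>
     ('t \<Rightarrow> 'a seed) \<Rightarrow> bool" where
  "seed_pattern r l V adj p S \<longleftrightarrow>
     labelled_regular_tree r V adj \<and>
     (\<forall>t\<in>V. is_seed r l (S t) \<and> (\<forall>j\<in>{1..l}. frozen (S t) j = p j)) \<and>
     (\<forall>t k t'. adj t k t' \<longrightarrow> is_mutation r l k (S t) (S t'))"

definition ext_cluster_vars :: "nat \<Rightarrow> nat \<Rightarrow> 't set \<Rightarrow> ('t \<Rightarrow> 'a seed) \<Rightarrow> 'a set" where
  "ext_cluster_vars r l V S = (\<Union>t\<in>V. cluster (S t) ` {1..r} \<union> frozen (S t) ` {1..l})"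

section \<open>Cluster algebras and friezes\<close>

definition cluster_algebra_int ::
  "nat \<Rightarrow> nat \<Rightarrow> 't set \<Rightarrow> ('t \<Rightarrow> 'a::field_char_0 seed) \<Rightarrow> 'a set \<Rightarrow> 'a set" where
  "cluster_algebra_int r l V S iv = is_subring hull (ext_cluster_vars r l V S \<union> inverse ` iv)"

text \<open>For a subring \<open>A\<close> of \<open>\<bbbF>\<close>, the tensor product of \<open>A\<close> with the rationals over the integers is
  realised inside \<open>\<bbbF>\<close> as the rational span of \<open>A\<close>, the tensor of \<open>a\<close> and \<open>q\<close> being
  \<open>of_rat q * a\<close>. Lemma \<open>rat_extension_universal\<close> below is its universal property.\<close>

definition rat_extension :: "'a::field_char_0 set \<Rightarrow> 'a set" where
  "rat_extension A = module.span (\<lambda>q x. of_rat q * x) A"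

definition cluster_algebra_rat ::
  "nat \<Rightarrow> nat \<Rightarrow> 't set \<Rightarrow> ('t \<Rightarrow> 'a::field_char_0 seed) \<Rightarrow> 'a set \<Rightarrow> 'a set" where
  "cluster_algebra_rat r l V S iv = rat_extension (cluster_algebra_int r l V S iv)"

definition rat_algebra_hom :: "'a::field_char_0 set \<Rightarrow> ('a \<Rightarrow> rat) \<Rightarrow> bool" where
  "rat_algebra_hom A h \<longleftrightarrow>
     h 1 = 1 \<and>
     (\<forall>x\<in>A. \<forall>y\<in>A. h (x + y) = h x + h y \<and> h (x * y) = h x * h y) \<and>
     (\<forall>q. \<forall>x\<in>A. h (of_rat q * x) = q * h x)"

definition is_frieze ::
  "nat \<Rightarrow> nat \<Rightarrow> 't set \<Rightarrow> ('t \<Rightarrow> 'a::field_char_0 seed) \<Rightarrow> 'a set \<Rightarrow> ('a \<Rightarrow> rat) \<Rightarrow> bool" where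
  "is_frieze r l V S iv h \<longleftrightarrow>
     rat_algebra_hom (cluster_algebra_rat r l V S iv) h \<and>
     (\<forall>u\<in>ext_cluster_vars r l V S. h u \<in> \<int> \<and> h u > 0)"

section \<open>The universal property of the rational extension\<close>

lemma module_of_rat: "module (\<lambda>q (x::'a::field_char_0). of_rat q * x)"
  by unfold_locales (auto simp: algebra_simps of_rat_add of_rat_mult)

lemma is_subring_zero: "is_subring A \<Longrightarrow> 0 \<in> A"
  unfolding is_subring_def by (metis diff_self)

lemma is_subring_uminus: "is_subring A \<Longrightarrow> x \<in> A \<Longrightarrow> - x \<in> A"
  using is_subring_zero[of A] unfolding is_subring_def by (metis diff_0)

lemma is_subring_add: "is_subring A \<Longrightarrow> x \<in> A \<Longrightarrow> y \<in> A \<Longrightarrow> x + y \<in> A"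
  using is_subring_uminus[of A y] unfolding is_subring_def by (metis diff_minus_eq_add)

lemma is_subring_of_nat: "is_subring A \<Longrightarrow> of_nat n \<in> A"
  by (induction n) (auto simp: is_subring_zero is_subring_add is_subring_def)

lemma is_subring_of_int: "is_subring A \<Longrightarrow> of_int n \<in> A"
  by (cases n) (auto intro: is_subring_of_nat is_subring_uminus simp del: of_nat_Suc)

lemma is_subring_mult: "is_subring A \<Longrightarrow> x \<in> A \<Longrightarrow> y \<in> A \<Longrightarrow> x * y \<in> A"
  by (simp add: is_subring_def)

lemma rat_extension_fraction:
  fixes A :: "'a::field_char_0 set"
  assumes A: "is_subring A" and x: "x \<in> rat_extension A"
  shows "\<exists>n::nat. \<exists>a\<in>A. n > 0 \<and> of_nat n * x = a"
proof -
  interpret module "\<lambda>q (x::'a). of_rat q * x" by (rule module_of_rat)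
  from x have "x \<in> span A" by (simp add: rat_extension_def)
  then show ?thesis
  proof (induction rule: span_induct_alt)
    case base
    then show ?case using is_subring_zero[OF A] by (intro exI[of _ 1]) auto
  next
    case (step c a y)
    obtain n where n: "n > 0" "of_nat n * y \<in> A" using step by blast
    obtain s t where st: "quotient_of c = (s, t)" by fastforce
    have t: "t > 0" using quotient_of_denom_pos[OF st] .
    have c: "c = of_int s / of_int t" using quotient_of_div[OF st] .
    have "of_nat (n * nat t) * (of_rat c * a + y)
        = of_nat n * of_int s * a + of_int t * (of_nat n * y)"
      using t by (simp add: c of_rat_divide field_simps)
    moreover have "\<dots> \<in> A"
      by (intro is_subring_add is_subring_mult is_subring_of_nat is_subring_of_int A n step)
    ultimately show ?case using n t by (intro exI[of _ "n * nat t"]) auto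
  qed
qed

lemma additive_on_of_nat:
  fixes f :: "'a::field_char_0 \<Rightarrow> 'm::ab_group_add"
  assumes A: "is_subring A" and f: "\<And>x y. x \<in> A \<Longrightarrow> y \<in> A \<Longrightarrow> f (x + y) = f x + f y" and a: "a \<in> A"
  shows "f (of_nat n * a) = (((+) (f a)) ^^ n) 0"
proof (induction n)
  case 0
  show ?case using f[OF is_subring_zero[OF A] is_subring_zero[OF A]] by simp
next
  case (Suc n)
  have "f (of_nat (Suc n) * a) = f a + f (of_nat n * a)"
    using f[OF a is_subring_mult[OF A is_subring_of_nat[OF A, of n] a]] by (simp add: algebra_simps)
  then show ?case using Suc by simp
qed

lemma rat_extension_universal:
  fixes A :: "'a::field_char_0 set" and f :: "'a \<Rightarrow> rat \<Rightarrow> 'm::ab_group_add"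
  assumes A: "is_subring A"
    and f1: "\<And>x y q. x \<in> A \<Longrightarrow> y \<in> A \<Longrightarrow> f (x + y) q = f x q + f y q"
    and f2: "\<And>x p q. x \<in> A \<Longrightarrow> f x (p + q) = f x p + f x q"
  shows "\<exists>g. (\<forall>x\<in>rat_extension A. \<forall>y\<in>rat_extension A. g (x + y) = g x + g y) \<and>
             (\<forall>a\<in>A. \<forall>q. g (of_rat q * a) = f a q)"
    and "\<lbrakk>\<forall>x\<in>rat_extension A. \<forall>y\<in>rat_extension A. g (x + y) = g x + g y;
          \<forall>a\<in>A. \<forall>q. g (of_rat q * a) = f a q;
          \<forall>x\<in>rat_extension A. \<forall>y\<in>rat_extension A. g' (x + y) = g' x + g' y;
          \<forall>a\<in>A. \<forall>q. g' (of_rat q * a) = f a q; x \<in> rat_extension A\<rbrakk> \<Longrightarrow> g x = g' x"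
proof -
  have bal: "f (of_nat n * a) q = f a (of_nat n * q)" if a: "a \<in> A" for n a q
  proof -
    have "f (of_nat n * a) q = (((+) (f a q)) ^^ n) 0"
      using additive_on_of_nat[OF A _ a, of "\<lambda>x. f x q"] f1 by simp
    also have "\<dots> = f a (of_nat n * q)"
      using additive_on_of_nat[of UNIV "f a" q n] f2[OF a] by (simp add: is_subring_def)
    finally show ?thesis .
  qed
  have bal_int: "f (of_int n * a) q = f a (of_int n * q)" if a: "a \<in> A" for n a q
  proof (cases n)
    case (nonneg m)
    then show ?thesis using bal[OF a] by simp
  next
    case (neg m)
    have m: "of_nat (Suc m) * a \<in> A" by (intro is_subring_mult is_subring_of_nat A a)
    have "f (- (of_nat (Suc m) * a)) q = - f (of_nat (Suc m) * a) q"
      using f1[OF m is_subring_uminus[OF A m], of q] f1[OF is_subring_zero[OF A] is_subring_zero[OF A], of q]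
      by (simp add: eq_neg_iff_add_eq_0 add.commute)
    moreover have "f a (- (of_nat (Suc m) * q)) = - f a (of_nat (Suc m) * q)"
      using f2[OF a, of "of_nat (Suc m) * q" "- (of_nat (Suc m) * q)"] f2[OF a, of 0 0]
      by (simp add: eq_neg_iff_add_eq_0 add.commute del: of_nat_Suc)
    ultimately show ?thesis using neg bal[OF a, of "Suc m" q] by (simp del: of_nat_Suc)
  qed
  define den where "den x = (SOME n::nat. n > 0 \<and> of_nat n * x \<in> A)" for x :: 'a
  have den: "den x > 0" "of_nat (den x) * x \<in> A" if "x \<in> rat_extension A" for x
    using someI_ex[of "\<lambda>n::nat. n > 0 \<and> of_nat n * x \<in> A"] rat_extension_fraction[OF A that]
    unfolding den_def by auto
  define g where "g x = f (of_nat (den x) * x) (1 / of_nat (den x))" for x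
  have geq: "g x = f (of_nat n * x) (1 / of_nat n)"
    if x: "x \<in> rat_extension A" and n: "n > 0" "of_nat n * x \<in> A" for x n
  proof -
    have "g x = f (of_nat (den x) * x) (of_nat n * (1 / (of_nat n * of_nat (den x))))"
      using n by (simp add: g_def)
    also have "\<dots> = f (of_nat n * (of_nat (den x) * x)) (1 / (of_nat n * of_nat (den x)))"
      using bal[OF den(2)[OF x]] by simp
    also have "\<dots> = f (of_nat (den x) * (of_nat n * x)) (1 / (of_nat n * of_nat (den x)))"
      by (simp add: ac_simps)
    also have "\<dots> = f (of_nat n * x) (of_nat (den x) * (1 / (of_nat n * of_nat (den x))))"
      using bal[OF n(2)] by simp
    also have "\<dots> = f (of_nat n * x) (1 / of_nat n)" using den(1)[OF x] by simp
    finally show ?thesis .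
  qed
  interpret module "\<lambda>q (x::'a). of_rat q * x" by (rule module_of_rat)
  have add: "x + y \<in> rat_extension A" if "x \<in> rat_extension A" "y \<in> rat_extension A" for x y
    using that by (simp add: rat_extension_def span_add)
  have tens: "of_rat q * a \<in> rat_extension A" if "a \<in> A" for q a
    using that by (simp add: rat_extension_def span_scale span_base)
  have "g (x + y) = g x + g y" if x: "x \<in> rat_extension A" and y: "y \<in> rat_extension A" for x y
  proof -
    define n where "n = den x * den y"
    have n: "n > 0" using den x y by (simp add: n_def)
    have nx: "of_nat n * x \<in> A"
      using is_subring_mult[OF A is_subring_of_nat[OF A, of "den y"] den(2)[OF x]]
      by (simp add: n_def ac_simps)
    have ny: "of_nat n * y \<in> A"
      using is_subring_mult[OF A is_subring_of_nat[OF A, of "den x"] den(2)[OF y]]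
      by (simp add: n_def ac_simps)
    have nxy: "of_nat n * (x + y) \<in> A" using is_subring_add[OF A nx ny] by (simp add: algebra_simps)
    show ?thesis
      using geq[OF add[OF x y] n nxy] geq[OF x n nx] geq[OF y n ny] f1[OF nx ny]
      by (simp add: algebra_simps)
  qed
  moreover have "g (of_rat q * a) = f a q" if a: "a \<in> A" for a q
  proof -
    obtain s t where st: "quotient_of q = (s, t)" by fastforce
    have t: "t > 0" using quotient_of_denom_pos[OF st] .
    have q: "q = of_int s / of_int t" using quotient_of_div[OF st] .
    have eq: "of_nat (nat t) * (of_rat q * a) = of_int s * a"
      using t by (simp add: q of_rat_divide)
    have "of_nat (nat t) * (of_rat q * a) \<in> A"
      unfolding eq by (intro is_subring_mult is_subring_of_int A a)
    then have "g (of_rat q * a) = f (of_int s * a) (1 / of_nat (nat t))"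
      using geq[OF tens[OF a], of "nat t" q] t unfolding eq by simp
    also have "\<dots> = f a q" using bal_int[OF a] t by (simp add: q)
    finally show ?thesis .
  qed
  ultimately show "\<exists>g. (\<forall>x\<in>rat_extension A. \<forall>y\<in>rat_extension A. g (x + y) = g x + g y) \<and>
             (\<forall>a\<in>A. \<forall>q. g (of_rat q * a) = f a q)" by blast
  show "g x = g' x" if "\<forall>a\<in>A. \<forall>q. g (of_rat q * a) = f a q"
      "\<forall>a\<in>A. \<forall>q. g' (of_rat q * a) = f a q" "x \<in> rat_extension A" for g g' x
  proof -
    obtain n :: nat where n: "n > 0" "of_nat n * x \<in> A"
      using rat_extension_fraction[OF A \<open>x \<in> rat_extension A\<close>] by blast
    have "x = of_rat (1 / of_nat n) * (of_nat n * x)" using n by (simp add: of_rat_divide)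
    then show ?thesis using that n(2) by metis
  qed
qed

end

theory Submission
  imports Defs
begin

text \<open>Positivity spreads from one seed to all others: \<open>h\<close> turns an exchange relation into
  \<open>h u\<^sub>k * h u'\<^sub>k = M + N\<close>, where \<open>M\<close> and \<open>N\<close> are monomials in values at the old extended cluster, so
  \<open>h u'\<^sub>k\<close> is positive as soon as these values are, and the tree is connected. Integrality is checked
  on generators, since the elements of a ring with integral value form a subring.\<close>

lemma is_subring_Inter: "(\<And>R. R \<in> T \<Longrightarrow> is_subring R) \<Longrightarrow> is_subring (\<Inter>T)"
  by (simp add: is_subring_def)

lemma is_subring_hull: "is_subring (is_subring hull X)"
  by (rule hull_in) (blast intro: is_subring_Inter)

lemma subset_rat_extension: "A \<subseteq> rat_extension A"
proof -
  interpret module "\<lambda>q (x::'a). of_rat q * x" by (rule module_of_rat)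
  show ?thesis by (auto simp: rat_extension_def intro: span_base)
qed

lemma rat_algebra_hom_subset: "rat_algebra_hom B h \<Longrightarrow> A \<subseteq> B \<Longrightarrow> rat_algebra_hom A h"
  unfolding rat_algebra_hom_def by (meson subsetD)

text \<open>Here \<open>h\<close> is a total function about which nothing is known off
  \<open>A\<close>, so each use of additivity or multiplicativity needs membership in
  \<open>A\<close>. This is why the positivity lemmas below carry membership along.\<close>

context
  fixes A :: "'a::field_char_0 set" and h :: "'a \<Rightarrow> rat"
  assumes A: "is_subring A" and h: "rat_algebra_hom A h"
begin

lemma hom_diff:
  assumes "x \<in> A" "y \<in> A"
  shows "h (x - y) = h x - h y"
proof -
  \<comment> \<open>Negation is scaling by the rational -1, so the scalar clause of
    \<open>rat_algebra_hom\<close> applies.\<close>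
  have "h (- y) = - h y"
    using h assms(2) unfolding rat_algebra_hom_def by (metis mult_minus1 of_rat_1 of_rat_minus)
  moreover have "h (x + - y) = h x + h (- y)"
    using h assms is_subring_uminus[OF A] unfolding rat_algebra_hom_def by blast
  ultimately show ?thesis by simp
qed

lemma integral_on_hull:
  assumes "X \<subseteq> A" "\<And>x. x \<in> X \<Longrightarrow> h x \<in> \<int>" and y: "y \<in> is_subring hull X"
  shows "h y \<in> \<int>"
proof -
  \<comment> \<open>Cutting down to \<open>A\<close> makes the set closed under the ring operations,
    and the hull is the least subring containing \<open>X\<close>.\<close>
  have "is_subring {x \<in> A. h x \<in> \<int>}"
    using A h by (auto simp: is_subring_def rat_algebra_hom_def hom_diff)
  then have "is_subring hull X \<subseteq> {x \<in> A. h x \<in> \<int>}"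
    using assms by (intro hull_minimal) auto
  then show ?thesis using y by blast
qed

lemma power_pos:
  assumes "x \<in> A" "h x > 0"
  shows "x ^ n \<in> A \<and> h (x ^ n) > 0"
  using assms A h by (induction n) (auto simp: is_subring_def rat_algebra_hom_def)

text \<open>Exponents of the form \<open>pos_part\<close> are non-negative, so \<open>powi\<close>
  is an ordinary power and the monomial stays in \<open>A\<close> although \<open>A\<close> need not
  contain inverses.\<close>

lemma monomial_pos:
  assumes "\<And>i. i \<in> I \<Longrightarrow> x i \<in> A \<and> h (x i) > 0"
  shows "(\<Prod>i\<in>I. x i powi pos_part (c i)) \<in> A \<and> h (\<Prod>i\<in>I. x i powi pos_part (c i)) > 0"
  using assms
proof (induction I rule: infinite_finite_induct)
  case (insert i I)
  have "x i powi pos_part (c i) \<in> A \<and> h (x i powi pos_part (c i)) > 0"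
    using power_pos[of "x i"] insert.prems[of i] by (simp add: power_int_def pos_part_def)
  with insert A h show ?case by (auto simp: is_subring_def rat_algebra_hom_def)
qed (use A h in \<open>auto simp: is_subring_def rat_algebra_hom_def\<close>)

lemma mutation_pos:
  assumes mut: "is_mutation r l k \<Sigma> \<Sigma>'" and k: "k \<in> {1..r}"
    and u: "\<And>j. j \<in> {1..r} \<Longrightarrow> cluster \<Sigma> j \<in> A \<and> h (cluster \<Sigma> j) > 0"
    and p: "\<And>j. j \<in> {1..l} \<Longrightarrow> frozen \<Sigma> j \<in> A \<and> h (frozen \<Sigma> j) > 0"
    and u': "cluster \<Sigma>' k \<in> A" and j: "j \<in> {1..r}"
  shows "h (cluster \<Sigma>' j) > 0"
proof (cases "j = k")
  case True
  \<comment> \<open>The sign \<open>s\<close> lets one formula give both monomials of the exchange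
    relation, at 1 and -1.\<close>
  define mon where "mon s = (\<Prod>i=1..r. cluster \<Sigma> i powi pos_part (s * exmat \<Sigma> i k)) *
      (\<Prod>i=1..l. frozen \<Sigma> i powi pos_part (s * exmat \<Sigma> (r + i) k))" for s
  have mon: "mon s \<in> A \<and> h (mon s) > 0" for s
    using monomial_pos[of "{1..r}" "cluster \<Sigma>" "\<lambda>i. s * exmat \<Sigma> i k"]
      monomial_pos[of "{1..l}" "frozen \<Sigma>" "\<lambda>i. s * exmat \<Sigma> (r + i) k"] u p A h
    unfolding mon_def by (simp add: is_subring_def rat_algebra_hom_def)
  have "cluster \<Sigma> k * cluster \<Sigma>' k = mon 1 + mon (- 1)"
    using mut by (simp add: is_mutation_def Let_def mon_def)
  then have "h (cluster \<Sigma> k) * h (cluster \<Sigma>' k) = h (mon 1) + h (mon (- 1))"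
    using u[OF k] u' mon h unfolding rat_algebra_hom_def by metis
  also have "\<dots> > 0" using mon by (simp add: add_pos_pos)
  \<comment> \<open>The positive factor \<open>h (cluster \<Sigma> k)\<close> cancels from the
    positive product.\<close>
  finally show ?thesis using u[OF k] True zero_less_mult_pos by blast
next
  case False
  then show ?thesis using mut u[OF j] j by (simp add: is_mutation_def Let_def)
qed

lemma seed_pattern_pos:
  assumes S: "seed_pattern r l V adj p S" and vars: "ext_cluster_vars r l V S \<subseteq> A"
    and t0: "t0 \<in> V" and pos: "\<And>j. j \<in> {1..r+l} \<Longrightarrow> h (ext_cluster r (S t0) j) > 0"
    and x: "x \<in> ext_cluster_vars r l V S"
  shows "h x > 0"
proof -
  have tree: "labelled_regular_tree r V adj" using S by (simp add: seed_pattern_def)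
  have frozen: "frozen (S t) j = p j" if "t \<in> V" "j \<in> {1..l}" for t j
    using S that by (simp add: seed_pattern_def)
  have mem: "j \<in> {1..r} \<Longrightarrow> cluster (S t) j \<in> A" "j \<in> {1..l} \<Longrightarrow> frozen (S t) j \<in> A"
    if "t \<in> V" for t j
    using vars that unfolding ext_cluster_vars_def by blast+
  have p_pos: "h (p j) > 0" if "j \<in> {1..l}" for j
    using pos[of "r + j"] that frozen[OF t0 that] by (simp add: ext_cluster_def)
  have pos_all: "\<forall>j\<in>{1..r}. h (cluster (S t) j) > 0" if "t \<in> V" for t
  proof -
    \<comment> \<open>Connectedness yields a path from \<open>t0\<close> to \<open>t\<close>; the
      induction mutates along its edges.\<close>
    have "(\<lambda>x y. \<exists>k. adj x k y)\<^sup>*\<^sup>* t0 t"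
      using tree t0 that by (simp add: labelled_regular_tree_def)
    then show ?thesis
    proof (induction rule: rtranclp_induct)
      case base
      show ?case
      proof
        fix j assume "j \<in> {1..r}"
        then show "h (cluster (S t0) j) > 0" using pos[of j] by (simp add: ext_cluster_def)
      qed
    next
      case (step s t)
      then obtain k where k: "adj s k t" by blast
      then have V: "s \<in> V" "t \<in> V" "k \<in> {1..r}" and mut: "is_mutation r l k (S s) (S t)"
        using tree S unfolding labelled_regular_tree_def seed_pattern_def by blast+
      show ?case
      proof
        fix j assume "j \<in> {1..r}"
        then show "h (cluster (S t) j) > 0"
          using mutation_pos[OF mut V(3)] step.IH mem V frozen p_pos by simp
      qed
    qed
  qed
  from x obtain t where "t \<in> V" "x \<in> cluster (S t) ` {1..r} \<union> frozen (S t) ` {1..l}"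
    unfolding ext_cluster_vars_def by blast
  then show ?thesis using pos_all p_pos frozen by auto
qed

end

theorem lemma3p5:
  fixes r l :: nat
    and V :: "'t set" and adj :: "'t \<Rightarrow> nat \<Rightarrow> 't \<Rightarrow> bool"
    and p :: "nat \<Rightarrow> 'a::field_char_0" and S :: "'t \<Rightarrow> 'a seed"
    and Z iv :: "'a set" and t0 :: 't and h :: "'a \<Rightarrow> rat"
  assumes "seed_pattern r l V adj p S"
    and "Z \<subseteq> ext_cluster_vars r l V S"
    and "cluster_algebra_int r l V S {} = is_subring hull Z"
    and "t0 \<in> V"
    and "iv \<subseteq> p ` {1..l}"
    and "rat_algebra_hom (cluster_algebra_rat r l V S iv) h"
  shows "is_frieze r l V S iv h \<longleftrightarrow>
           (\<forall>z\<in>Z. h z \<in> \<int>) \<and> (\<forall>j\<in>{1..r+l}. h (ext_cluster r (S t0) j) > 0)"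
proof
  assume frieze: "is_frieze r l V S iv h"
  have "ext_cluster r (S t0) j \<in> ext_cluster_vars r l V S" if "j \<in> {1..r+l}" for j
  proof (cases "j \<le> r")
    case True
    then have "j \<in> {1..r}" using that by auto
    then show ?thesis using True assms(4) by (force simp: ext_cluster_def ext_cluster_vars_def)
  next
    case False
    then have "j - r \<in> {1..l}" using that by auto
    then show ?thesis using False assms(4) by (force simp: ext_cluster_def ext_cluster_vars_def)
  qed
  then show "(\<forall>z\<in>Z. h z \<in> \<int>) \<and> (\<forall>j\<in>{1..r+l}. h (ext_cluster r (S t0) j) > 0)"
    using frieze assms(2) unfolding is_frieze_def by blast
next
  assume conds: "(\<forall>z\<in>Z. h z \<in> \<int>) \<and> (\<forall>j\<in>{1..r+l}. h (ext_cluster r (S t0) j) > 0)"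
  \<comment> \<open>This ring contains all extended cluster variables and lies in the domain of
    \<open>h\<close>, so both general lemmas apply to it.\<close>
  define A where "A = cluster_algebra_int r l V S iv"
  have A: "is_subring A" by (simp add: A_def cluster_algebra_int_def is_subring_hull)
  have h: "rat_algebra_hom A h"
    using assms(6) subset_rat_extension unfolding A_def cluster_algebra_rat_def
    by (rule rat_algebra_hom_subset)
  have vars: "ext_cluster_vars r l V S \<subseteq> A"
    unfolding A_def cluster_algebra_int_def using hull_subset by fast
  have "h u \<in> \<int>" if "u \<in> ext_cluster_vars r l V S" for u
  proof (rule integral_on_hull[OF A h])
    show "Z \<subseteq> A" using assms(2) vars by blast
    \<comment> \<open>The subring generated by \<open>Z\<close> is the cluster algebra with nothing
      inverted. It contains every extended cluster variable but need not contain the inverses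
      adjoined in \<open>A\<close>, whose values may be non-integral.\<close>
    show "u \<in> is_subring hull Z"
      using that unfolding assms(3)[symmetric] cluster_algebra_int_def by (simp add: hull_inc)
  qed (use conds in blast)
  moreover have "h u > 0" if "u \<in> ext_cluster_vars r l V S" for u
    using seed_pattern_pos[OF A h assms(1) vars assms(4) _ that] conds by blast
  ultimately show "is_frieze r l V S iv h" using assms(6) by (simp add: is_frieze_def)
qed

end
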